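(* Let $\vec\alpha\,F$ be an $n$-ary BNF and $\sim$ a type-polymorphic family of equivalence relations on $\vec\alpha\,F$ such that $x\sim y$ implies $\mathrm{map}_F\,\vec f\,x\sim\mathrm{map}_F\,\vec f\,y$ for all $\vec f$. Suppose there is a type-polymorphic family of confluent relations $\rightsquigarrow$ on $\vec\alpha\,F$ such that (i) ${\sim}\subseteq{\overset{*}{\leftrightsquigarrow}}$, where $\overset{*}{\leftrightsquigarrow}$ is the equivalence closure of $\rightsquigarrow$; and (ii) whenever $\mathrm{map}_F\,\overrightarrow{\mathrm{fst}}\,x\rightsquigarrow y$, there exists $y'$ with $y=\mathrm{map}_F\,\overrightarrow{\mathrm{fst}}\,y'$, $x\sim y'$, and $\mathrm{set}_{F,i}\,y'\subseteq\mathrm{set}_{F,i}\,x$ for all $i$; and similarly with $\mathrm{snd}$ in place of $\mathrm{fst}$. Then for all relations $\vec R,\vec S$ with $R_i\bullet S_i\neq\emptyset$ for all $i$, $$\mathrm{rel}_F\,\vec R\bullet{\sim}\bullet\mathrm{rel}_F\,\vec S\subseteq{\sim}\bullet\mathrm{rel}_F\,\overrightarrow{(R\bullet S)}\bullet{\sim}.$$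
   Context: HOL setting (all types non-empty); vector notation $\vec x=x_1,\dots,x_n$ with synchronized indices. Relations are identified with sets of pairs and $\bullet$ is relation composition. An $n$-ary BNF is a type constructor $\vec\alpha\,F$ with polymorphic mapper $\mathrm{map}_F::(\alpha_1\to\beta_1)\to\cdots\to(\alpha_n\to\beta_n)\to\vec\alpha\,F\to\vec\beta\,F$, setters $\mathrm{set}_{F,i}::\vec\alpha\,F\to\alpha_i\ \mathrm{set}$, infinite cardinal bound $\mathrm{bd}_F$, relator $\mathrm{rel}_F$, satisfying: $\mathrm{map}_F\,\vec{\mathrm{id}}=\mathrm{id}$; $\mathrm{map}_F\,\vec g\circ\mathrm{map}_F\,\vec f=\mathrm{map}_F\,\overrightarrow{(g\circ f)}$; $\mathrm{set}_{F,i}(\mathrm{map}_F\,\vec f\,x)=f_i\langle\mathrm{set}_{F,i}\,x\rangle$; if $f_i z=g_i z$ for all $i$ and $z\in\mathrm{set}_{F,i}\,x$ then $\mathrm{map}_F\,\vec f\,x=\mathrm{map}_F\,\vec g\,x$; $|\mathrm{set}_{F,i}\,x|\le\mathrm{bd}_F$; $(x,y)\in\mathrm{rel}_F\,\vec R$ iff some $z$ has $\mathrm{set}_{F,i}\,z\subseteq R_i$ for all $i$, $\mathrm{map}_F\,\overrightarrow{\mathrm{fst}}\,z=x$, $\mathrm{map}_F\,\overrightarrow{\mathrm{snd}}\,z=y$; $\mathrm{rel}_F\,\vec R\bullet\mathrm{rel}_F\,\vec S\subseteq\mathrm{rel}_F\,\overrightarrow{(R\bullet S)}$. A relation $\rightsquigarrow$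 is confluent if whenever $x\overset{*}{\rightsquigarrow}y$ and $x\overset{*}{\rightsquigarrow}z$ there is $u$ with $y\overset{*}{\rightsquigarrow}u$ and $z\overset{*}{\rightsquigarrow}u$, where $\overset{*}{\rightsquigarrow}$ is the reflexive–transitive closure. In (ii), $x$ ranges over $F$ applied to pair types, $\mathrm{map}_F\,\overrightarrow{\mathrm{fst}}\,x$ projects to the first components, and $\sim$ is used at the pair type. *)

theory Defs
  imports Main "HOL-Library.Confluence"
begin

unbundle cardinal_syntax

text \<open>
  HOL cannot quantify over type constructors, so types are modelled, as in the standard semantics of
  HOL, by nonempty sets: here nonempty sets of elements of \<open>'a obj\<close>, a universe that contains an
  arbitrary type \<open>'a\<close> of atoms and is freely closed under pairing. Any finite collection of HOL types
  embeds into it (take their sum for \<open>'a\<close>), and it is closed under the product types that occur in the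
  characterisation of the relator and in the lifting condition on reductions. A vector of types is a
  function on the finite index type \<open>'n\<close>, so the arity is \<open>CARD('n)\<close>. A type-polymorphic family is a
  function of the vector of types at which it is instantiated.
\<close>

datatype 'a obj = Atom 'a | Pr (ofst: "'a obj") (osnd: "'a obj")

type_synonym ('n, 'a) tyvec = "'n \<Rightarrow> 'a obj set"

definition types :: "('n, 'a) tyvec \<Rightarrow> bool" where
  "types A \<longleftrightarrow> (\<forall>i. A i \<noteq> {})"

definition as_objs :: "('a obj \<times> 'a obj) set \<Rightarrow> 'a obj set" where
  "as_objs R = (\<lambda>(a, b). Pr a b) ` R"

definition prod_ty :: "('n, 'a) tyvec \<Rightarrow> ('n, 'a) tyvec \<Rightarrow> ('n, 'a) tyvec" where
  "prod_ty A B = (\<lambda>i. as_objs (A i \<times> B i))"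

definition funs :: "('n, 'a) tyvec \<Rightarrow> ('n, 'a) tyvec \<Rightarrow> ('n \<Rightarrow> 'a obj \<Rightarrow> 'a obj) set" where
  "funs A B = {f. \<forall>i. f i ` A i \<subseteq> B i}"

definition rels :: "('n, 'a) tyvec \<Rightarrow> ('n, 'a) tyvec \<Rightarrow> ('n \<Rightarrow> ('a obj \<times> 'a obj) set) set" where
  "rels A B = {R. \<forall>i. R i \<subseteq> A i \<times> B i}"

text \<open>
  \<open>F A\<close> is the carrier of the type constructor applied to the vector \<open>A\<close>; \<open>mapF A B\<close> is the instance
  of the mapper for functions from \<open>A\<close> to \<open>B\<close>, and similarly for the setters and the relator.
\<close>

locale nary_bnf =
  fixes F :: "('n::finite, 'a) tyvec \<Rightarrow> 'f set"
    and mapF :: "('n, 'a) tyvec \<Rightarrow> ('n, 'a) tyvec \<Rightarrow> ('n \<Rightarrow> 'a obj \<Rightarrow> 'a obj) \<Rightarrow> 'f \<Rightarrow> 'f"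
    and setF :: "('n, 'a) tyvec \<Rightarrow> 'n \<Rightarrow> 'f \<Rightarrow> 'a obj set"
    and bdF :: "'k rel"
    and relF :: "('n, 'a) tyvec \<Rightarrow> ('n, 'a) tyvec \<Rightarrow> ('n \<Rightarrow> ('a obj \<times> 'a obj) set) \<Rightarrow> 'f rel"
  assumes F_nonempty: "types A \<Longrightarrow> F A \<noteq> {}"
    and map_type: "\<lbrakk>types A; types B; f \<in> funs A B; x \<in> F A\<rbrakk> \<Longrightarrow> mapF A B f x \<in> F B"
    and set_type: "\<lbrakk>types A; x \<in> F A\<rbrakk> \<Longrightarrow> setF A i x \<subseteq> A i"
    and rel_type: "\<lbrakk>types A; types B; R \<in> rels A B\<rbrakk> \<Longrightarrow> relF A B R \<subseteq> F A \<times> F B"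
    and map_id: "\<lbrakk>types A; x \<in> F A\<rbrakk> \<Longrightarrow> mapF A A (\<lambda>i. id) x = x"
    and map_comp: "\<lbrakk>types A; types B; types C; f \<in> funs A B; g \<in> funs B C; x \<in> F A\<rbrakk>
      \<Longrightarrow> mapF B C g (mapF A B f x) = mapF A C (\<lambda>i. g i \<circ> f i) x"
    and set_map: "\<lbrakk>types A; types B; f \<in> funs A B; x \<in> F A\<rbrakk>
      \<Longrightarrow> setF B i (mapF A B f x) = f i ` setF A i x"
    and map_cong: "\<lbrakk>types A; types B; f \<in> funs A B; g \<in> funs A B; x \<in> F A;
        \<And>i z. z \<in> setF A i x \<Longrightarrow> f i z = g i z\<rbrakk> \<Longrightarrow> mapF A B f x = mapF A B g x"
    and bd_cinfinite: "Cinfinite bdF"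
    and set_bd: "\<lbrakk>types A; x \<in> F A\<rbrakk> \<Longrightarrow> |setF A i x| \<le>o bdF"
    and in_rel: "\<lbrakk>types A; types B; R \<in> rels A B\<rbrakk> \<Longrightarrow> (x, y) \<in> relF A B R \<longleftrightarrow>
        (\<exists>z \<in> F (prod_ty A B). (\<forall>i. setF (prod_ty A B) i z \<subseteq> as_objs (R i)) \<and>
          mapF (prod_ty A B) A (\<lambda>i. ofst) z = x \<and> mapF (prod_ty A B) B (\<lambda>i. osnd) z = y)"
    and rel_comp: "\<lbrakk>types A; types B; types C; R \<in> rels A B; S \<in> rels B C\<rbrakk>
      \<Longrightarrow> relF A B R O relF B C S \<subseteq> relF A C (\<lambda>i. R i O S i)"

end

theory Submission
  imports Defs
begin

text \<open>
  By confluence, \<open>\<sim>\<close>-equivalent elements \<open>u\<close> and \<open>v\<close> reduce to a common \<open>t\<close>. If \<open>z\<close> and \<open>w\<close> witness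
  \<open>(x, u) \<in> rel R\<close> and \<open>(v, y) \<in> rel S\<close>, condition (ii) lifts these reductions step by step to witnesses
  \<open>z' \<sim> z\<close> and \<open>w' \<sim> w\<close> whose inner projections are both \<open>t\<close>. Their outer projections are then related
  by \<open>rel R \<bullet> rel S \<subseteq> rel (R \<bullet> S)\<close>, and they are equivalent to \<open>x\<close> and \<open>y\<close> because maps preserve \<open>\<sim>\<close>.
\<close>

lemma types_prod_ty: "types A \<Longrightarrow> types B \<Longrightarrow> types (prod_ty A B)"
  by (auto simp: types_def prod_ty_def as_objs_def)

lemma ofst_funs: "(\<lambda>i. ofst) \<in> funs (prod_ty A B) A"
  and osnd_funs: "(\<lambda>i. osnd) \<in> funs (prod_ty A B) B"
  by (auto simp: funs_def prod_ty_def as_objs_def)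

text \<open>Extends the lifting condition (ii) from one reduction step to many. \<open>p\<close>
  stands for either projection, so one induction serves both sides. Keeping the lifted element in
  \<open>X\<close> lets the condition apply again, and transitivity of \<open>E\<close> and of
  inclusion carries the two invariants along.\<close>

lemma rtranclp_lift:
  assumes step: "\<And>x y. \<lbrakk>x \<in> X; r (p x) y\<rbrakk> \<Longrightarrow>
      \<exists>y'\<in>X. y = p y' \<and> (x, y') \<in> E \<and> (\<forall>i. s i y' \<subseteq> s i x)"
    and E: "equiv X E"
    and x: "x \<in> X"
    and red: "r\<^sup>*\<^sup>* (p x) y"
  shows "\<exists>y'\<in>X. y = p y' \<and> (x, y') \<in> E \<and> (\<forall>i. s i y' \<subseteq> s i x)"
  using red
proof (induction rule: rtranclp_induct)
  case base
  show ?case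
    using x equiv_class_self[OF E x] by blast
next
  case (step y z)
  then obtain y' where y': "y' \<in> X" "y = p y'" "(x, y') \<in> E" "\<And>i. s i y' \<subseteq> s i x"
    by blast
  \<comment> \<open>Since \<open>y = p y'\<close>, the last reduction step starts at a projection
    again and can be lifted from \<open>y'\<close>.\<close>
  then obtain z' where z': "z' \<in> X" "z = p z'" "(y', z') \<in> E" "\<And>i. s i z' \<subseteq> s i y'"
    using assms(1)[of y' z] step.hyps(2) by blast
  have "(x, z') \<in> E"
    using E y'(3) z'(3) by (meson equivE transD)
  moreover have "s i z' \<subseteq> s i x" for i
    using y'(4) z'(4) by blast
  ultimately show ?case
    using z' by blast
qed

theorem theorem3p21:
  fixes F :: "('n::finite, 'a) tyvec \<Rightarrow> 'f set"
    and mapF :: "('n, 'a) tyvec \<Rightarrow> ('n, 'a) tyvec \<Rightarrow> ('n \<Rightarrow> 'a obj \<Rightarrow> 'a obj) \<Rightarrow> 'f \<Rightarrow> 'f"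
    and setF :: "('n, 'a) tyvec \<Rightarrow> 'n \<Rightarrow> 'f \<Rightarrow> 'a obj set"
    and bdF :: "'k rel"
    and relF :: "('n, 'a) tyvec \<Rightarrow> ('n, 'a) tyvec \<Rightarrow> ('n \<Rightarrow> ('a obj \<times> 'a obj) set) \<Rightarrow> 'f rel"
    and sim red :: "('n, 'a) tyvec \<Rightarrow> 'f rel"
    and A B C :: "('n, 'a) tyvec"
    and R S :: "'n \<Rightarrow> ('a obj \<times> 'a obj) set"
  assumes F_bnf: "nary_bnf F mapF setF bdF relF"
    and sim_equiv: "\<And>T. types T \<Longrightarrow> equiv (F T) (sim T)"
    and sim_map: "\<And>T U f x y. \<lbrakk>types T; types U; f \<in> funs T U; (x, y) \<in> sim T\<rbrakk>
      \<Longrightarrow> (mapF T U f x, mapF T U f y) \<in> sim U"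
    and red_type: "\<And>T. types T \<Longrightarrow> red T \<subseteq> F T \<times> F T"
    and red_confluent: "\<And>T. types T \<Longrightarrow> confluentp (\<lambda>x y. (x, y) \<in> red T)"
    and sim_red: "\<And>T. types T \<Longrightarrow> sim T \<subseteq> {(x, y). equivclp (\<lambda>x y. (x, y) \<in> red T) x y}"
    and red_fst: "\<And>T U x y. \<lbrakk>types T; types U; x \<in> F (prod_ty T U);
        (mapF (prod_ty T U) T (\<lambda>i. ofst) x, y) \<in> red T\<rbrakk>
      \<Longrightarrow> \<exists>y' \<in> F (prod_ty T U). y = mapF (prod_ty T U) T (\<lambda>i. ofst) y' \<and>
            (x, y') \<in> sim (prod_ty T U) \<and>
            (\<forall>i. setF (prod_ty T U) i y' \<subseteq> setF (prod_ty T U) i x)"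
    and red_snd: "\<And>T U x y. \<lbrakk>types T; types U; x \<in> F (prod_ty T U);
        (mapF (prod_ty T U) U (\<lambda>i. osnd) x, y) \<in> red U\<rbrakk>
      \<Longrightarrow> \<exists>y' \<in> F (prod_ty T U). y = mapF (prod_ty T U) U (\<lambda>i. osnd) y' \<and>
            (x, y') \<in> sim (prod_ty T U) \<and>
            (\<forall>i. setF (prod_ty T U) i y' \<subseteq> setF (prod_ty T U) i x)"
    and ABC: "types A" "types B" "types C"
    and R: "R \<in> rels A B"
    and S: "S \<in> rels B C"
    and RS: "\<And>i. R i O S i \<noteq> {}"
  shows "relF A B R O sim B O relF B C S \<subseteq> sim A O relF A C (\<lambda>i. R i O S i) O sim C"
proof (rule subrelI)
  interpret nary_bnf F mapF setF bdF relF
    by (fact F_bnf)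
  note AB = types_prod_ty[OF ABC(1,2)] and BC = types_prod_ty[OF ABC(2,3)]
  fix x y
  assume "(x, y) \<in> relF A B R O sim B O relF B C S"
  then obtain u v where xu: "(x, u) \<in> relF A B R" and uv: "(u, v) \<in> sim B"
    and vy: "(v, y) \<in> relF B C S"
    by blast
  obtain z where z: "z \<in> F (prod_ty A B)" "\<And>i. setF (prod_ty A B) i z \<subseteq> as_objs (R i)"
      "mapF (prod_ty A B) A (\<lambda>i. ofst) z = x" "mapF (prod_ty A B) B (\<lambda>i. osnd) z = u"
    using xu in_rel[OF ABC(1,2) R] by blast
  obtain w where w: "w \<in> F (prod_ty B C)" "\<And>i. setF (prod_ty B C) i w \<subseteq> as_objs (S i)"
      "mapF (prod_ty B C) B (\<lambda>i. ofst) w = v" "mapF (prod_ty B C) C (\<lambda>i. osnd) w = y"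
    using vy in_rel[OF ABC(2,3) S] by blast
  let ?r = "\<lambda>x y. (x, y) \<in> red B"
  have "equivclp ?r u v"
    using sim_red[OF ABC(2)] uv by blast
  \<comment> \<open>Church-Rosser: under confluence, the equivalence closure is joinability.\<close>
  then have "(?r\<^sup>*\<^sup>* OO ?r\<inverse>\<inverse>\<^sup>*\<^sup>*) u v"
    using semiconfluentp_equivclp[OF confluentp_imp_semiconfluentp[OF red_confluent[OF ABC(2)]]]
    by simp
  then obtain t where ut: "?r\<^sup>*\<^sup>* u t" and vt: "?r\<^sup>*\<^sup>* v t"
    by (auto simp: rtranclp_conversep)
  \<comment> \<open>The middle type \<open>B\<close> is the second component for \<open>z\<close>
    but the first for \<open>w\<close>, so the lifts go along \<open>osnd\<close> here and along
    \<open>ofst\<close> for \<open>w\<close>.\<close>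
  obtain z' where z': "z' \<in> F (prod_ty A B)" "t = mapF (prod_ty A B) B (\<lambda>i. osnd) z'"
      "(z, z') \<in> sim (prod_ty A B)" "\<And>i. setF (prod_ty A B) i z' \<subseteq> setF (prod_ty A B) i z"
    using rtranclp_lift[where r = ?r and p = "mapF (prod_ty A B) B (\<lambda>i. osnd)" and s = "setF (prod_ty A B)",
        OF red_snd[OF ABC(1,2)] sim_equiv[OF AB] z(1)] ut z(4)
    by blast
  obtain w' where w': "w' \<in> F (prod_ty B C)" "t = mapF (prod_ty B C) B (\<lambda>i. ofst) w'"
      "(w, w') \<in> sim (prod_ty B C)" "\<And>i. setF (prod_ty B C) i w' \<subseteq> setF (prod_ty B C) i w"
    using rtranclp_lift[where r = ?r and p = "mapF (prod_ty B C) B (\<lambda>i. ofst)" and s = "setF (prod_ty B C)",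
        OF red_fst[OF ABC(2,3)] sim_equiv[OF BC] w(1)] vt w(3)
    by blast
  let ?x = "mapF (prod_ty A B) A (\<lambda>i. ofst) z'" and ?y = "mapF (prod_ty B C) C (\<lambda>i. osnd) w'"
  \<comment> \<open>The witness is \<open>z'\<close>: its sets lie in those of \<open>z\<close>,
    hence in \<open>R\<close>.\<close>
  have "(?x, t) \<in> relF A B R"
    unfolding in_rel[OF ABC(1,2) R] using z(2) z'(1,2,4) by blast
  moreover have "(t, ?y) \<in> relF B C S"
    unfolding in_rel[OF ABC(2,3) S] using w(2) w'(1,2,4) by blast
  ultimately have "(?x, ?y) \<in> relF A C (\<lambda>i. R i O S i)"
    using rel_comp[OF ABC R S] by blast
  moreover have "(x, ?x) \<in> sim A"
    using sim_map[OF AB ABC(1) ofst_funs z'(3)] z(3) by simp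
  \<comment> \<open>Mapping \<open>w\<close> and \<open>w'\<close> gives \<open>y\<close> equivalent
    to \<open>?y\<close>; the composition needs the converse, hence symmetry.\<close>
  moreover have "(?y, y) \<in> sim C"
    using sim_map[OF BC ABC(3) osnd_funs w'(3)] w(4) sim_equiv[OF ABC(3)]
    by (metis equivE symD)
  ultimately show "(x, y) \<in> sim A O relF A C (\<lambda>i. R i O S i) O sim C"
    by blast
qed

end
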